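(* Consider a full exponential family having polyhedral convex support $C\subset\mathbb{R}^p$ and observed value $y$ of the natural statistic such that $y\in C$. Let $V\subset\mathbb{R}^p$ be a finite set with $T_C(y)=\mathrm{con}(\mathrm{pos}\,V)$, and define $$L=\{v\in V:-v\in T_C(y)\}.$$ Then a generic direction of recession exists if and only if $L\neq V$, in which case a vector $\delta\in\mathbb{R}^p$ is a generic direction of recession if and only if $$\langle w,\delta\rangle=0\quad\text{for all } w\in L,$$ $$\langle w,\delta\rangle<0\quad\text{for all } w\in V\setminus L.$$
   Context: Full exponential family: there is a measurable space $\Omega$, a measurable map $Y:\Omega\to\mathbb{R}^p$ (the natural statistic), a probability measure $P_\psi$ on $\Omega$ labelled by some $\psi\in\mathbb{R}^p$, and a real number $c(\psi)$. The cumulant function is $c(\theta)=c(\psi)+\log E_\psi(e^{\langle Y,\theta-\psi\rangle})$ for all $\theta\in\mathbb{R}^p$, with $c(\theta)=\infty$ when the expectation is infinite. The natural parameter space is $\Theta=\{\theta\in\mathbb{R}^p: c(\theta)<\infty\}$ (all of it is used; this is fullness). For $\theta\in\Theta$, the distribution with parameter $\theta$ has density $e^{\langle Y(\omega),\theta-\psi\rangle-c(\theta)+c(\psi)}$ with respect to $P_\psi$. Here $\langle\cdot,\cdot\rangle$ is the standard bilinear form $\langle y,\theta\rangle=\sum_i y_i\theta_i$. The convex support $C$ is the smallest closed convex subset of $\mathbb{R}^p$ that contains $Y$ with probability one under some (equivalently every) distribution in the family. Polyhedral means an intersection of finitely many closed half-spaces. For a convex set $C$ and $y\in C$: the tangent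 cone is $T_C(y)=\mathrm{cl}\{s(w-y): w\in C,\ s\ge 0\}$, and the normal cone is $N_C(y)=\{\delta\in\mathbb{R}^p:\langle w-y,\delta\rangle\le 0\text{ for all }w\in C\}$. For a finite set $V$, $\mathrm{con}(\mathrm{pos}\,V)$ is the set of all linear combinations of elements of $V$ with nonnegative coefficients (it is $\{0\}$ if $V$ is empty). A vector $\delta$ is a generic direction of recession if $\delta\in\mathrm{rint}\,N_C(y)$ and $N_C(y)$ is not a vector subspace, where $\mathrm{rint}$ denotes relative interior (interior relative to the affine hull). *)

theory Defs
  imports "HOL-Probability.Probability"
begin

text \<open>
  The probability space \<^term>\<open>P\<close> is the member of the family labelled by \<^term>\<open>\<psi>\<close>. The
  expectation defining the cumulant function is a Lebesgue integral of a positive function,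
  so it is formed in \<^typ>\<open>ennreal\<close>; it is never zero, and when it is finite its logarithm is
  the real logarithm.
\<close>

definition log_mgf :: "'w measure \<Rightarrow> ('w \<Rightarrow> real ^ 'p) \<Rightarrow> real ^ 'p \<Rightarrow> ereal" where
  "log_mgf P Y t =
    (let E = (\<integral>\<^sup>+ \<omega>. ennreal (exp (Y \<omega> \<bullet> t)) \<partial>P)
     in if E = \<infinity> then \<infinity> else ereal (ln (enn2real E)))"

locale full_exponential_family = prob_space P
  for P :: "'w measure" +
  fixes Y :: "'w \<Rightarrow> real ^ 'p"
    and \<psi> :: "real ^ 'p"
    and c :: "real ^ 'p \<Rightarrow> ereal"
  assumes natural_statistic_measurable: "Y \<in> borel_measurable P"
    and cumulant_base_finite: "\<bar>c \<psi>\<bar> \<noteq> \<infinity>"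
    and cumulant_eq: "c \<theta> = c \<psi> + log_mgf P Y (\<theta> - \<psi>)"

definition natural_parameter_space :: "(real ^ 'p \<Rightarrow> ereal) \<Rightarrow> (real ^ 'p) set" where
  "natural_parameter_space c = {\<theta>. c \<theta> < \<infinity>}"

definition family_distribution ::
    "'w measure \<Rightarrow> ('w \<Rightarrow> real ^ 'p) \<Rightarrow> real ^ 'p \<Rightarrow> (real ^ 'p \<Rightarrow> ereal) \<Rightarrow> real ^ 'p \<Rightarrow> 'w measure"
  where
  "family_distribution P Y \<psi> c \<theta> =
    density P (\<lambda>\<omega>. ennreal (exp (Y \<omega> \<bullet> (\<theta> - \<psi>) - real_of_ereal (c \<theta>) + real_of_ereal (c \<psi>))))"

definition is_convex_support ::
    "'w measure \<Rightarrow> ('w \<Rightarrow> real ^ 'p) \<Rightarrow> real ^ 'p \<Rightarrow> (real ^ 'p \<Rightarrow> ereal) \<Rightarrow> (real ^ 'p) set \<Rightarrow> bool"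
  where
  "is_convex_support P Y \<psi> c C \<longleftrightarrow>
    (let carries = (\<lambda>K. closed K \<and> convex K \<and>
           (\<exists>\<theta> \<in> natural_parameter_space c. AE \<omega> in family_distribution P Y \<psi> c \<theta>. Y \<omega> \<in> K))
     in carries C \<and> (\<forall>K. carries K \<longrightarrow> C \<subseteq> K))"

definition tangent_cone :: "(real ^ 'p) set \<Rightarrow> real ^ 'p \<Rightarrow> (real ^ 'p) set" where
  "tangent_cone C y = closure {s *\<^sub>R (w - y) | s w. w \<in> C \<and> 0 \<le> s}"

definition normal_cone :: "(real ^ 'p) set \<Rightarrow> real ^ 'p \<Rightarrow> (real ^ 'p) set" where
  "normal_cone C y = {\<delta>. \<forall>w \<in> C. (w - y) \<bullet> \<delta> \<le> 0}"

text \<open>Intended for finite \<^term>\<open>V\<close>: the sum over an infinite set is zero by convention.\<close>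

definition con_pos :: "(real ^ 'p) set \<Rightarrow> (real ^ 'p) set" where
  "con_pos V = {\<Sum>v\<in>V. a v *\<^sub>R v | a :: real ^ 'p \<Rightarrow> real. \<forall>v\<in>V. 0 \<le> a v}"

definition generic_direction_of_recession :: "(real ^ 'p) set \<Rightarrow> real ^ 'p \<Rightarrow> real ^ 'p \<Rightarrow> bool" where
  "generic_direction_of_recession C y \<delta> \<longleftrightarrow>
    \<delta> \<in> rel_interior (normal_cone C y) \<and> \<not> subspace (normal_cone C y)"

context full_exponential_family
begin

lemma log_mgf_zero: "log_mgf P Y 0 = 0"
  by (simp add: log_mgf_def emeasure_space_1)

lemma base_in_natural_parameter_space: "\<psi> \<in> natural_parameter_space c"
  using cumulant_base_finite by (auto simp: natural_parameter_space_def)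

lemma family_distribution_base: "family_distribution P Y \<psi> c \<psi> = P"
  by (simp add: family_distribution_def density_1)

lemma prob_space_family_distribution:
  assumes "\<theta> \<in> natural_parameter_space c"
  shows "prob_space (family_distribution P Y \<psi> c \<theta>)"
proof
  have [measurable]: "Y \<in> borel_measurable P"
    by (rule natural_statistic_measurable)
  define E where "E = (\<integral>\<^sup>+ \<omega>. ennreal (exp (Y \<omega> \<bullet> (\<theta> - \<psi>))) \<partial>P)"
  obtain b where b: "c \<psi> = ereal b"
    using cumulant_base_finite by auto
  have fin: "E \<noteq> \<infinity>"
    using assms cumulant_eq[of \<theta>] b
    by (auto simp: natural_parameter_space_def log_mgf_def Let_def E_def)
  have "E \<noteq> 0"
  proof
    assume "E = 0"
    then have "AE \<omega> in P. ennreal (exp (Y \<omega> \<bullet> (\<theta> - \<psi>))) = 0"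
      unfolding E_def by (subst (asm) nn_integral_0_iff_AE) auto
    then have "AE \<omega> in P. False"
      by (rule eventually_mono) simp
    then show False
      by simp
  qed
  with fin obtain r where r: "E = ennreal r" "0 < r"
    by (cases E) (auto simp: less_le)
  have c: "c \<theta> = ereal (b + ln r)"
    using cumulant_eq[of \<theta>] b r fin by (simp add: log_mgf_def Let_def flip: E_def)
  have "emeasure (family_distribution P Y \<psi> c \<theta>) (space (family_distribution P Y \<psi> c \<theta>))
      = (\<integral>\<^sup>+ \<omega>. ennreal (exp (- ln r)) * ennreal (exp (Y \<omega> \<bullet> (\<theta> - \<psi>))) \<partial>P)"
    unfolding family_distribution_def
    by (subst emeasure_density)
       (auto simp: c b algebra_simps simp flip: ennreal_mult exp_add intro!: nn_integral_cong)
  also have "\<dots> = ennreal (exp (- ln r)) * E"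
    unfolding E_def by (rule nn_integral_cmult) measurable
  also have "\<dots> = 1"
    using r by (simp add: exp_minus flip: ennreal_mult)
  finally show "emeasure (family_distribution P Y \<psi> c \<theta>)
      (space (family_distribution P Y \<psi> c \<theta>)) = 1" .
qed

lemma AE_family_distribution_iff:
  "(AE \<omega> in family_distribution P Y \<psi> c \<theta>. Q \<omega>) \<longleftrightarrow> (AE \<omega> in P. Q \<omega>)"
proof -
  have [measurable]: "Y \<in> borel_measurable P"
    by (rule natural_statistic_measurable)
  show ?thesis
    unfolding family_distribution_def by (subst AE_density) auto
qed

lemma is_convex_support_iff:
  "is_convex_support P Y \<psi> c C \<longleftrightarrow>
    closed C \<and> convex C \<and> (AE \<omega> in P. Y \<omega> \<in> C) \<and>
    (\<forall>K. closed K \<longrightarrow> convex K \<longrightarrow> (AE \<omega> in P. Y \<omega> \<in> K) \<longrightarrow> C \<subseteq> K)"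
  unfolding is_convex_support_def Let_def AE_family_distribution_iff
  using base_in_natural_parameter_space by blast

lemma ex1_convex_support: "\<exists>!C. is_convex_support P Y \<psi> c C"
proof -
  define \<K> where "\<K> = {K. closed K \<and> convex K \<and> (AE \<omega> in P. Y \<omega> \<in> K)}"
  obtain \<U> where \<U>: "\<U> \<subseteq> uminus ` \<K>" "countable \<U>" "\<Union>\<U> = \<Union>(uminus ` \<K>)"
    by (rule Lindelof[of "uminus ` \<K>"]) (auto simp: \<K>_def open_Compl)
  have "AE \<omega> in P. \<forall>U\<in>\<U>. Y \<omega> \<in> - U"
    unfolding AE_ball_countable[OF \<U>(2)] using \<U>(1) by (auto simp: \<K>_def)
  then have "AE \<omega> in P. Y \<omega> \<in> \<Inter>\<K>"
  proof (rule eventually_mono)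
    fix \<omega> assume "\<forall>U\<in>\<U>. Y \<omega> \<in> - U"
    then have "Y \<omega> \<notin> \<Union>(uminus ` \<K>)"
      by (auto simp flip: \<U>(3))
    then show "Y \<omega> \<in> \<Inter>\<K>"
      by auto
  qed
  then have "is_convex_support P Y \<psi> c (\<Inter>\<K>)"
    unfolding is_convex_support_iff by (auto simp: \<K>_def intro!: closed_Inter convex_Inter)
  moreover have "C = D" if "is_convex_support P Y \<psi> c C" "is_convex_support P Y \<psi> c D" for C D
    using that unfolding is_convex_support_iff by blast
  ultimately show ?thesis
    by blast
qed

end

end

theory Submission
  imports Defs
begin

text \<open>
  The normal cone \<open>N\<close> is the polar of the tangent cone \<open>T = con_pos V\<close>, hence cut out by the
  finitely many inequalities \<open>v \<bullet> \<delta> \<le> 0\<close> with \<open>v \<in> V\<close>. The generators in \<open>L\<close> are those for which the inequality is an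
  implicit equality: if \<open>-v \<in> T\<close>, then both \<open>v \<bullet> \<delta> \<le> 0\<close> and \<open>-v \<bullet> \<delta> \<le> 0\<close> on \<open>N\<close>. For any
  other generator \<open>v\<close>, separating \<open>-v\<close> from the closed convex cone \<open>T\<close> gives an element of \<open>N\<close>
  at which the inequality is strict, and adding these elements up gives one element of \<open>N\<close> at
  which all these inequalities are strict at once (\<open>ex_strictly_polar\<close>).

  So \<open>N\<close> consists of the solutions of a system of equations and of inequalities that can all be
  made strict together, and the relative interior of such a set is obtained by making the
  inequalities strict (\<open>rel_interior_polar_con_pos\<close>). The same strict solution shows that \<open>N\<close>
  is not closed under negation as soon as there is an inequality, that is, as soon as
  \<open>L \<noteq> V\<close>; otherwise \<open>N\<close> is defined by equations only and is a subspace.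
\<close>

section \<open>Polars of closed convex cones\<close>

text \<open>Passing to the closed cone generated by \<open>C - y\<close> adds no constraint on \<open>\<delta>\<close>, because the
  closed half-space \<open>{x. x \<bullet> \<delta> \<le> 0}\<close> is itself a closed cone.\<close>

lemma normal_cone_eq_polar_tangent_cone:
  "normal_cone C y = {\<delta>. \<forall>x\<in>tangent_cone C y. x \<bullet> \<delta> \<le> 0}"
proof (intro equalityI subsetI; clarsimp)
  fix \<delta> x assume \<delta>: "\<delta> \<in> normal_cone C y" and x: "x \<in> tangent_cone C y"
  have "{s *\<^sub>R (w - y) | s w. w \<in> C \<and> 0 \<le> s} \<subseteq> {x. \<delta> \<bullet> x \<le> 0}"
    using \<delta> by (auto simp: normal_cone_def inner_commute intro!: mult_nonneg_nonpos)
  then have "tangent_cone C y \<subseteq> {x. \<delta> \<bullet> x \<le> 0}"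
    unfolding tangent_cone_def by (rule closure_minimal) (rule closed_halfspace_le)
  with x show "x \<bullet> \<delta> \<le> 0"
    by (auto simp: inner_commute)
next
  fix \<delta> assume polar: "\<forall>x\<in>tangent_cone C y. x \<bullet> \<delta> \<le> 0"
  have "w - y \<in> tangent_cone C y" if "w \<in> C" for w
  proof -
    have "1 *\<^sub>R (w - y) \<in> {s *\<^sub>R (w - y) | s w. w \<in> C \<and> 0 \<le> s}"
      using that zero_le_one by blast
    then show ?thesis
      unfolding tangent_cone_def using closure_subset by fastforce
  qed
  with polar show "\<delta> \<in> normal_cone C y"
    by (auto simp: normal_cone_def)
qed

lemma convex_cone_con_pos: "convex_cone (con_pos V)"
proof -
  have zero: "0 \<in> con_pos V"
    unfolding con_pos_def by (auto intro!: exI[of _ "\<lambda>_. 0"])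
  have add: "x + z \<in> con_pos V" if xz: "x \<in> con_pos V" "z \<in> con_pos V" for x z
  proof -
    obtain a b where "x = (\<Sum>v\<in>V. a v *\<^sub>R v)" "\<forall>v\<in>V. 0 \<le> a v"
        "z = (\<Sum>v\<in>V. b v *\<^sub>R v)" "\<forall>v\<in>V. 0 \<le> b v"
      using xz unfolding con_pos_def by blast
    then show ?thesis
      unfolding con_pos_def
      by (auto intro!: exI[of _ "\<lambda>v. a v + b v"] simp: scaleR_add_left sum.distrib)
  qed
  have scale: "t *\<^sub>R x \<in> con_pos V" if xt: "x \<in> con_pos V" "0 \<le> t" for x t
  proof -
    obtain a where "x = (\<Sum>v\<in>V. a v *\<^sub>R v)" "\<forall>v\<in>V. 0 \<le> a v"
      using xt unfolding con_pos_def by blast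
    with \<open>0 \<le> t\<close> show ?thesis
      unfolding con_pos_def
      by (auto intro!: exI[of _ "\<lambda>v. t * a v"] simp: scaleR_sum_right)
  qed
  show ?thesis
    using zero add scale by (simp add: convex_cone_iff)
qed

lemma con_pos_superset:
  assumes "finite V"
  shows "V \<subseteq> con_pos V"
proof
  fix u assume "u \<in> V"
  then have "u = (\<Sum>v\<in>V. (if v = u then 1 else 0) *\<^sub>R v)"
    using assms by (simp add: if_distrib[of "\<lambda>r. r *\<^sub>R _"] sum.delta cong: if_cong)
  then show "u \<in> con_pos V"
    unfolding con_pos_def by (auto intro!: exI[of _ "\<lambda>v. if v = u then 1 else 0"])
qed

lemma polar_con_pos:
  assumes "finite V"
  shows "{\<delta>. \<forall>x\<in>con_pos V. x \<bullet> \<delta> \<le> 0} = {\<delta>. \<forall>v\<in>V. v \<bullet> \<delta> \<le> 0}"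
proof (intro equalityI subsetI; clarsimp)
  fix \<delta> v assume "\<forall>x\<in>con_pos V. x \<bullet> \<delta> \<le> 0" "v \<in> V"
  then show "v \<bullet> \<delta> \<le> 0"
    using con_pos_superset[OF assms] by blast
next
  fix \<delta> x assume "\<forall>v\<in>V. v \<bullet> \<delta> \<le> 0" "x \<in> con_pos V"
  then show "x \<bullet> \<delta> \<le> 0"
    by (auto simp: con_pos_def inner_sum_left intro!: sum_nonpos mult_nonneg_nonpos)
qed

text \<open>A hyperplane that strictly separates a point from a cone can be moved to the origin: a
  linear form that is bounded below on a cone is nonnegative there.\<close>

lemma separating_polar_element:
  fixes K :: "'a::euclidean_space set"
  assumes cone: "convex_cone K" and "closed K" and "z \<notin> K"
  shows "\<exists>\<delta>. (\<forall>x\<in>K. x \<bullet> \<delta> \<le> 0) \<and> 0 < z \<bullet> \<delta>"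
proof -
  have "convex K" "0 \<in> K"
    using cone by (auto simp: convex_cone_def conic_contains_0)
  obtain a b where ab: "a \<bullet> z < b" "\<And>x. x \<in> K \<Longrightarrow> b < a \<bullet> x"
    using separating_hyperplane_closed_point[OF \<open>convex K\<close> \<open>closed K\<close> \<open>z \<notin> K\<close>] by blast
  have "b < 0"
    using ab(2)[OF \<open>0 \<in> K\<close>] by simp
  have "0 \<le> a \<bullet> x" if "x \<in> K" for x
  proof (rule ccontr)
    assume neg: "\<not> 0 \<le> a \<bullet> x"
    \<comment> \<open>The multiple of \<open>x\<close> at which the linear form takes the forbidden value \<open>b\<close>.\<close>
    define t where "t = b / (a \<bullet> x)"
    have "0 \<le> t"
      using neg \<open>b < 0\<close> by (simp add: t_def divide_nonpos_neg)
    then have "t *\<^sub>R x \<in> K"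
      using cone \<open>x \<in> K\<close> by (simp add: convex_cone_scaleR)
    then have "b < t * (a \<bullet> x)"
      using ab(2) by fastforce
    then show False
      using neg by (simp add: t_def)
  qed
  then show ?thesis
    using ab(1) \<open>b < 0\<close> by (intro exI[of _ "- a"]) (auto simp: inner_commute)
qed

section \<open>The relative interior of a polyhedral polar cone\<close>

text \<open>The sum over all \<open>v \<in> V - L\<close> of polar elements that separate \<open>-v\<close> from the cone: in the
  product with a fixed \<open>v\<close> no summand is positive, and the one belonging to \<open>v\<close> is negative.\<close>

lemma ex_strictly_polar:
  fixes V :: "(real ^ 'p) set"
  assumes "finite V" and "closed (con_pos V)" and L: "L = {v \<in> V. - v \<in> con_pos V}"
  shows "\<exists>\<delta>. (\<forall>v\<in>V. v \<bullet> \<delta> \<le> 0) \<and> (\<forall>v\<in>V - L. v \<bullet> \<delta> < 0)"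
proof -
  have "\<forall>v\<in>V - L. \<exists>\<delta>. (\<forall>x\<in>con_pos V. x \<bullet> \<delta> \<le> 0) \<and> v \<bullet> \<delta> < 0"
  proof
    fix v assume "v \<in> V - L"
    then have "- v \<notin> con_pos V"
      using L by blast
    from separating_polar_element[OF convex_cone_con_pos \<open>closed (con_pos V)\<close> this]
    show "\<exists>\<delta>. (\<forall>x\<in>con_pos V. x \<bullet> \<delta> \<le> 0) \<and> v \<bullet> \<delta> < 0"
      by simp
  qed
  from bchoice[OF this] obtain d where
    d: "\<And>v x. v \<in> V - L \<Longrightarrow> x \<in> con_pos V \<Longrightarrow> x \<bullet> d v \<le> 0"
      "\<And>v. v \<in> V - L \<Longrightarrow> v \<bullet> d v < 0"
    by blast
  have nonpos: "u \<bullet> d v \<le> 0" if "u \<in> V" "v \<in> V - L" for u v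
    using d(1) that con_pos_superset[OF \<open>finite V\<close>] by blast
  have "v \<bullet> sum d (V - L) < 0" if v: "v \<in> V - L" for v
  proof -
    have "v \<bullet> sum d (V - L) = v \<bullet> d v + (\<Sum>u\<in>V - L - {v}. v \<bullet> d u)"
      unfolding inner_sum_right using v \<open>finite V\<close> by (simp add: sum.remove)
    also have "\<dots> < 0"
      using d(2)[OF v] nonpos v by (intro add_neg_nonpos sum_nonpos) auto
    finally show ?thesis .
  qed
  moreover have "v \<bullet> sum d (V - L) \<le> 0" if "v \<in> V" for v
    using nonpos that by (auto simp: inner_sum_right intro!: sum_nonpos)
  ultimately show ?thesis
    by blast
qed

lemma polar_lineality_orthogonal:
  assumes "finite V" and L: "L = {v \<in> V. - v \<in> con_pos V}"
    and "\<forall>v\<in>V. v \<bullet> \<delta> \<le> 0" and "w \<in> L"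
  shows "w \<bullet> \<delta> = 0"
proof -
  have "- w \<bullet> \<delta> \<le> 0"
    using polar_con_pos[OF \<open>finite V\<close>] assms(2-4) by blast
  moreover have "w \<bullet> \<delta> \<le> 0"
    using assms(2-4) by blast
  ultimately show ?thesis
    by simp
qed

text \<open>The polar lies in the orthogonal complement of \<open>L\<close>, and within that complement the strict
  inequalities define an open set; this shows that their solutions are relatively interior.
  Conversely, from a relatively interior point one may move a little further away from a strict
  solution without leaving the polar; the point then lies strictly between the strict solution
  and another point of the polar, and so is a strict solution itself.\<close>

lemma rel_interior_polar_con_pos:
  fixes V :: "(real ^ 'p) set"
  assumes "finite V" and "closed (con_pos V)" and L: "L = {v \<in> V. - v \<in> con_pos V}"
  shows "rel_interior {\<delta>. \<forall>v\<in>V. v \<bullet> \<delta> \<le> 0}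
    = {\<delta>. (\<forall>w\<in>L. w \<bullet> \<delta> = 0) \<and> (\<forall>w\<in>V - L. w \<bullet> \<delta> < 0)}"
    (is "rel_interior ?N = ?G")
proof (intro equalityI subsetI)
  fix \<delta> assume \<delta>: "\<delta> \<in> rel_interior ?N"
  then have "\<delta> \<in> ?N"
    using rel_interior_subset by blast
  obtain \<delta>\<^sub>0 where strict: "\<delta>\<^sub>0 \<in> ?N" "\<forall>v\<in>V - L. v \<bullet> \<delta>\<^sub>0 < 0"
    using ex_strictly_polar[OF assms] by blast
  have "convex ?N"
    by (auto simp: convex_def inner_add_right intro!: add_nonpos_nonpos mult_nonneg_nonpos)
  then obtain e where e: "1 < e" "(1 - e) *\<^sub>R \<delta>\<^sub>0 + e *\<^sub>R \<delta> \<in> ?N"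
    using \<delta> strict(1) convex_rel_interior_iff[of ?N \<delta>] by blast
  have "w \<bullet> \<delta> < 0" if w: "w \<in> V - L" for w
  proof -
    have "(1 - e) * (w \<bullet> \<delta>\<^sub>0) + e * (w \<bullet> \<delta>) \<le> 0"
      using e(2) w by (auto simp: inner_add_right)
    moreover have "0 < (1 - e) * (w \<bullet> \<delta>\<^sub>0)"
      using e(1) strict(2) w by (simp add: mult_neg_neg)
    ultimately have "e * (w \<bullet> \<delta>) < 0"
      by linarith
    then show ?thesis
      using e(1) by (simp add: mult_less_0_iff)
  qed
  then show "\<delta> \<in> ?G"
    using \<open>\<delta> \<in> ?N\<close> polar_lineality_orthogonal[OF \<open>finite V\<close> L] by blast
next
  fix \<delta> assume \<delta>: "\<delta> \<in> ?G"
  define U where "U = (\<Inter>w\<in>V - L. {x. w \<bullet> x < 0})"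
  have "open U"
    unfolding U_def using \<open>finite V\<close> by (intro open_INT ballI open_halfspace_lt) auto
  have "subspace {x. \<forall>w\<in>L. w \<bullet> x = 0}"
    by (auto simp: subspace_def inner_add_right)
  then have "affine hull ?N \<subseteq> {x. \<forall>w\<in>L. w \<bullet> x = 0}"
    using polar_lineality_orthogonal[OF \<open>finite V\<close> L]
    by (intro hull_minimal) (auto intro: subspace_imp_affine)
  then have hull: "w \<bullet> x = 0" if "x \<in> affine hull ?N" "w \<in> L" for x w
    using that by blast
  have "U \<inter> affine hull ?N \<subseteq> ?N"
  proof clarify
    fix x v assume x: "x \<in> U" "x \<in> affine hull ?N" and "v \<in> V"
    show "v \<bullet> x \<le> 0"
    proof (cases "v \<in> L")
      case True
      with hull x(2) show ?thesis by simp
    next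
      case False
      with x(1) \<open>v \<in> V\<close> have "v \<bullet> x < 0"
        by (auto simp: U_def)
      then show ?thesis by simp
    qed
  qed
  moreover have "\<delta> \<in> ?N"
  proof clarify
    fix v assume "v \<in> V"
    with \<delta> show "v \<bullet> \<delta> \<le> 0"
      by (cases "v \<in> L") (auto intro: less_imp_le)
  qed
  moreover have "\<delta> \<in> U"
    using \<delta> by (auto simp: U_def)
  ultimately show "\<delta> \<in> rel_interior ?N"
    using \<open>open U\<close> unfolding mem_rel_interior by blast
qed

lemma subspace_polar_con_pos_iff:
  fixes V :: "(real ^ 'p) set"
  assumes "finite V" and "closed (con_pos V)" and L: "L = {v \<in> V. - v \<in> con_pos V}"
  shows "subspace {\<delta>. \<forall>v\<in>V. v \<bullet> \<delta> \<le> 0} \<longleftrightarrow> L = V"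
    (is "subspace ?N \<longleftrightarrow> _")
proof
  assume sub: "subspace ?N"
  obtain \<delta> where \<delta>: "\<delta> \<in> ?N" "\<forall>v\<in>V - L. v \<bullet> \<delta> < 0"
    using ex_strictly_polar[OF assms] by blast
  have "- \<delta> \<in> ?N"
    using sub \<delta>(1) by (rule subspace_neg)
  then have "v \<notin> V - L" for v
    using \<delta>(2) by force
  then show "L = V"
    using L by blast
next
  assume "L = V"
  then have "?N = {\<delta>. \<forall>v\<in>V. v \<bullet> \<delta> = 0}"
    using polar_lineality_orthogonal[OF \<open>finite V\<close> L] by (auto intro: eq_refl)
  then show "subspace ?N"
    by (auto simp: subspace_def inner_add_right)
qed

section \<open>Generic directions of recession\<close>

theorem theorem7:
  fixes P :: "'w measure"
    and Y :: "'w \<Rightarrow> real ^ 'p"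
    and \<psi> :: "real ^ 'p"
    and c :: "real ^ 'p \<Rightarrow> ereal"
    and C :: "(real ^ 'p) set"
    and y :: "real ^ 'p"
    and V L :: "(real ^ 'p) set"
  assumes "full_exponential_family P Y \<psi> c"
    and "is_convex_support P Y \<psi> c C"
    and "polyhedron C"
    and "y \<in> C"
    and "finite V"
    and "tangent_cone C y = con_pos V"
    and "L = {v \<in> V. - v \<in> tangent_cone C y}"
  shows "((\<exists>\<delta>. generic_direction_of_recession C y \<delta>) \<longleftrightarrow> L \<noteq> V) \<and>
    (L \<noteq> V \<longrightarrow>
      (\<forall>\<delta>. generic_direction_of_recession C y \<delta> \<longleftrightarrow>
        (\<forall>w \<in> L. w \<bullet> \<delta> = 0) \<and> (\<forall>w \<in> V - L. w \<bullet> \<delta> < 0)))"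
proof -
  have T: "tangent_cone C y = con_pos V" and L: "L = {v \<in> V. - v \<in> con_pos V}"
    using assms(6,7) by auto
  have "closed (con_pos V)"
    unfolding T[symmetric] tangent_cone_def by simp
  note V = \<open>finite V\<close> this L
  have N: "normal_cone C y = {\<delta>. \<forall>v\<in>V. v \<bullet> \<delta> \<le> 0}"
    unfolding normal_cone_eq_polar_tangent_cone T by (rule polar_con_pos[OF \<open>finite V\<close>])
  have generic: "generic_direction_of_recession C y \<delta> \<longleftrightarrow>
      ((\<forall>w\<in>L. w \<bullet> \<delta> = 0) \<and> (\<forall>w\<in>V - L. w \<bullet> \<delta> < 0)) \<and> L \<noteq> V" for \<delta>
    unfolding generic_direction_of_recession_def N
      rel_interior_polar_con_pos[OF V] subspace_polar_con_pos_iff[OF V] by blast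
  have "\<exists>\<delta>. (\<forall>w\<in>L. w \<bullet> \<delta> = 0) \<and> (\<forall>w\<in>V - L. w \<bullet> \<delta> < 0)"
    using ex_strictly_polar[OF V] polar_lineality_orthogonal[OF \<open>finite V\<close> L] by blast
  then show ?thesis
    unfolding generic by blast
qed

end
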